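(* Let $P=\mathbb{S}^2\setminus\{\mathrm{pt}\}$ be the punctured round sphere, modelled as the complex plane $\mathbb{C}$ with the Riemannian metric $ds^2=\frac{4}{(1+(x^2+y^2))^2}(dx^2+dy^2)$, $z=x+iy$, of constant curvature $+1$, and equip $P\times\mathbb{R}$ with the product metric. Let $f:P\to\mathbb{C}$ be proper biharmonic and let $p:\mathbb{R}\to\mathbb{R}$ be a non-zero harmonic polynomial $p(t)=a_0+a_1t$. Then the function $$F(z,\bar z,t)=f(z,\bar z)\cdot p(t)$$ is proper biharmonic on $P\times\mathbb{R}$.
   Context: For a Riemannian manifold $(M,g)$, $\tau=\operatorname{div}\nabla$ denotes the Laplace-Beltrami operator acting on smooth complex-valued functions (the metric being extended complex-bilinearly), and $\tau^2(f)=\tau(\tau(f))$. A function $f:(M,g)\to\mathbb{C}$ is proper biharmonic if $\tau^2(f)=0$ and $\tau(f)$ does not vanish identically. The notation $f(z,\bar z)$ just denotes a (not necessarily holomorphic) function of the point $z$. *)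

theory Defs
  imports "HOL-Analysis.Analysis" "HOL-Computational_Algebra.Polynomial"
begin

text \<open>
  All manifolds here carry a single global chart: the underlying manifold is a Euclidean space
  \<open>'a\<close>, and a metric \<open>g\<close> assigns to a point \<open>x\<close> and tangent vectors \<open>u\<close>, \<open>v\<close> the number \<open>g x u v\<close>.
\<close>

type_synonym 'a metric = "'a \<Rightarrow> 'a \<Rightarrow> 'a \<Rightarrow> real"

definition riemannian_gradient ::
    "'a::euclidean_space metric \<Rightarrow> ('a \<Rightarrow> real) \<Rightarrow> 'a \<Rightarrow> 'a" where
  "riemannian_gradient g u x = (THE w. \<forall>v. g x w v = frechet_derivative u (at x) v)"

text \<open>Density of the Riemannian volume with respect to the coordinate volume: the square root of
  the determinant of the Gram matrix \<open>(g x b c)\<close> for \<open>b\<close>, \<open>c\<close> in \<open>Basis\<close>, by the Leibniz formula.\<close>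

definition volume_density :: "'a::euclidean_space metric \<Rightarrow> 'a \<Rightarrow> real" where
  "volume_density g x =
     sqrt (\<Sum>\<pi> | \<pi> permutes Basis. of_int (sign \<pi>) * (\<Prod>b\<in>Basis. g x b (\<pi> b)))"

definition riemannian_divergence ::
    "'a::euclidean_space metric \<Rightarrow> ('a \<Rightarrow> 'a) \<Rightarrow> 'a \<Rightarrow> real" where
  "riemannian_divergence g X x =
     (\<Sum>b\<in>Basis. frechet_derivative (\<lambda>y. volume_density g y * (X y \<bullet> b)) (at x) b)
       / volume_density g x"

definition laplace_beltrami_real ::
    "'a::euclidean_space metric \<Rightarrow> ('a \<Rightarrow> real) \<Rightarrow> 'a \<Rightarrow> real" where
  "laplace_beltrami_real g u = riemannian_divergence g (riemannian_gradient g u)"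

text \<open>For a complex-bilinearly extended metric the gradient and the divergence are complex-linear,
  so the operator acts separately on real and imaginary parts.\<close>

definition laplace_beltrami ::
    "'a::euclidean_space metric \<Rightarrow> ('a \<Rightarrow> complex) \<Rightarrow> 'a \<Rightarrow> complex" where
  "laplace_beltrami g f x =
     Complex (laplace_beltrami_real g (\<lambda>y. Re (f y)) x) (laplace_beltrami_real g (\<lambda>y. Im (f y)) x)"

primrec continuously_differentiable ::
    "nat \<Rightarrow> ('a::real_normed_vector \<Rightarrow> 'b::real_normed_vector) \<Rightarrow> bool" where
  "continuously_differentiable 0 f \<longleftrightarrow> continuous_on UNIV f"
| "continuously_differentiable (Suc k) f \<longleftrightarrow>
     (\<forall>x. f differentiable (at x)) \<and>
     (\<forall>v. continuously_differentiable k (\<lambda>x. frechet_derivative f (at x) v))"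

text \<open>Real smoothness; in particular a smooth map on \<open>complex\<close> need not be holomorphic.\<close>

definition smooth :: "('a::euclidean_space \<Rightarrow> 'b::real_normed_vector) \<Rightarrow> bool" where
  "smooth f \<longleftrightarrow> (\<forall>k. continuously_differentiable k f)"

definition harmonic :: "'a::euclidean_space metric \<Rightarrow> ('a \<Rightarrow> complex) \<Rightarrow> bool" where
  "harmonic g f \<longleftrightarrow> smooth f \<and> (\<forall>x. laplace_beltrami g f x = 0)"

definition proper_biharmonic :: "'a::euclidean_space metric \<Rightarrow> ('a \<Rightarrow> complex) \<Rightarrow> bool" where
  "proper_biharmonic g f \<longleftrightarrow>
     smooth f \<and> (\<forall>x. laplace_beltrami g (laplace_beltrami g f) x = 0) \<and>
     (\<exists>x. laplace_beltrami g f x \<noteq> 0)"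

definition flat_metric :: "'a::euclidean_space metric" where
  "flat_metric x u v = u \<bullet> v"

definition product_metric :: "'a metric \<Rightarrow> 'b metric \<Rightarrow> ('a \<times> 'b) metric" where
  "product_metric g h x u v = g (fst x) (fst u) (fst v) + h (snd x) (snd u) (snd v)"

text \<open>The once punctured unit sphere in its stereographic coordinate; on \<open>complex\<close> the inner
  product is \<open>dx\<^sup>2 + dy\<^sup>2\<close>.\<close>

definition punctured_sphere_metric :: "complex metric" where
  "punctured_sphere_metric z u v = 4 / (1 + ((Re z)\<^sup>2 + (Im z)\<^sup>2))\<^sup>2 * (u \<bullet> v)"

end

theory Submission
  imports Defs
begin

text \<open>
  In coordinates in which the metric is diagonal, \<open>g = \<Sum>\<^sub>b w\<^sub>b dx\<^sub>b\<^sup>2\<close> with volume density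
  \<open>\<rho> = sqrt (\<Prod>\<^sub>b w\<^sub>b)\<close>, the Laplace-Beltrami operator is
  \<open>\<Delta>u = \<rho>\<^sup>-\<^sup>1 \<Sum>\<^sub>b \<partial>\<^sub>b (\<rho> w\<^sub>b\<^sup>-\<^sup>1 \<partial>\<^sub>b u)\<close> (\<open>laplace_beltrami_real_diagonal\<close>). The product of two diagonal
  metrics is again diagonal, its volume density is the product of the two densities, and each
  coefficient depends on one factor only. Hence, in the formula for \<open>\<Delta>(u(x) h(y))\<close>, everything that
  depends on the other factor can be pulled out of each \<open>\<partial>\<^sub>b\<close>, which gives
  \<open>\<Delta>(u(x) h(y)) = \<Delta>u(x) h(y) + u(x) \<Delta>h(y)\<close> (\<open>laplace_beltrami_real_product\<close>).

  If \<open>h\<close> is harmonic this reads \<open>\<Delta>(f h) = (\<Delta>f) h\<close>. The right-hand side is of the same shape, so the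
  identity applies again and yields \<open>\<Delta>\<^sup>2(f h) = (\<Delta>\<^sup>2f) h = 0\<close>, while \<open>\<Delta>(f h)\<close> is nonzero at
  \<open>(x, y)\<close> as soon as \<open>\<Delta>f(x)\<close> and \<open>h(y)\<close> are. The punctured sphere in its stereographic coordinate is
  conformally flat, in particular diagonal, and a nonzero polynomial has a non-root.

  Since the value of \<open>frechet_derivative\<close> carries no information where a function is not
  differentiable, the argument depends on \<open>\<Delta>f\<close> being smooth again. This is why the class of
  smooth functions is first shown to be closed under the operations in the formula for \<open>\<Delta>\<close>.
\<close>

section \<open>Closure properties of smooth functions\<close>

text \<open>Smoothness itself does not support an induction, so closure under an operation is shown for
  each finite order \<open>k\<close>, by induction on \<open>k\<close>: this rule reduces order \<open>k + 1\<close> to order \<open>k\<close> for the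
  derivative that the calculus rule for the operation provides.\<close>

lemma continuously_differentiable_SucI:
  assumes "\<And>x. (f has_derivative f' x) (at x)"
    and "\<And>v. continuously_differentiable k (\<lambda>x. f' x v)"
  shows "continuously_differentiable (Suc k) f"
proof -
  have "frechet_derivative f (at x) = f' x" for x
    using frechet_derivative_at[OF assms(1)] by simp
  then show ?thesis
    using assms by (auto simp: differentiable_def)
qed

lemma continuously_differentiable_SucD:
  assumes "continuously_differentiable (Suc k) f"
  shows "(f has_derivative frechet_derivative f (at x)) (at x)"
    and "continuously_differentiable k (\<lambda>x. frechet_derivative f (at x) v)"
  using assms by (auto simp flip: frechet_derivative_works)

lemma continuously_differentiable_Suc_imp:
  "continuously_differentiable (Suc k) f \<Longrightarrow> continuously_differentiable k f"
proof (induction k arbitrary: f)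
  case 0
  then show ?case
    by (auto intro!: continuous_at_imp_continuous_on differentiable_imp_continuous_within)
next
  case (Suc k)
  then show ?case by (meson continuously_differentiable.simps(2))
qed

lemma continuously_differentiable_const: "continuously_differentiable k (\<lambda>x. c)"
proof (induction k arbitrary: c)
  case (Suc k)
  show ?case
    by (rule continuously_differentiable_SucI[of _ "\<lambda>x v. 0"]) (auto intro: Suc)
qed simp

lemma continuously_differentiable_bounded_linear:
  assumes "bounded_linear L"
  shows "continuously_differentiable k L"
proof (cases k)
  case 0
  then show ?thesis
    using assms linear_continuous_on by auto
next
  case (Suc j)
  then show ?thesis
    using continuously_differentiable_SucI[of L "\<lambda>x. L"]
    by (simp add: assms bounded_linear_imp_has_derivative continuously_differentiable_const)
qed

lemma continuously_differentiable_add: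
  "continuously_differentiable k f \<Longrightarrow> continuously_differentiable k g \<Longrightarrow>
    continuously_differentiable k (\<lambda>x. f x + g x)"
proof (induction k arbitrary: f g)
  case (Suc k)
  note f = continuously_differentiable_SucD[OF Suc.prems(1)]
  note g = continuously_differentiable_SucD[OF Suc.prems(2)]
  show ?case
    by (rule continuously_differentiable_SucI[OF has_derivative_add[OF f(1) g(1)]])
      (intro Suc.IH f(2) g(2))
qed (auto intro: continuous_intros)

lemma continuously_differentiable_mult:
  fixes f g :: "'a::real_normed_vector \<Rightarrow> 'b::real_normed_algebra"
  shows "continuously_differentiable k f \<Longrightarrow> continuously_differentiable k g \<Longrightarrow>
    continuously_differentiable k (\<lambda>x. f x * g x)"
proof (induction k arbitrary: f g)
  case (Suc k)
  note f = continuously_differentiable_SucD[OF Suc.prems(1)]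
  note g = continuously_differentiable_SucD[OF Suc.prems(2)]
  note lower = Suc.prems[THEN continuously_differentiable_Suc_imp]
  show ?case
    by (rule continuously_differentiable_SucI[OF has_derivative_mult[OF f(1) g(1)]])
      (intro continuously_differentiable_add Suc.IH[OF lower(1) g(2)] Suc.IH[OF f(2) lower(2)])
qed (auto intro: continuous_intros)

lemma continuously_differentiable_linear_compose:
  assumes "bounded_linear L"
  shows "continuously_differentiable k f \<Longrightarrow> continuously_differentiable k (\<lambda>x. L (f x))"
proof (induction k arbitrary: f)
  case 0
  then show ?case
    using bounded_linear.continuous_on[OF assms] by simp
next
  case (Suc k)
  note f = continuously_differentiable_SucD[OF Suc.prems]
  show ?case
    by (rule continuously_differentiable_SucI[OF bounded_linear.has_derivative[OF assms f(1)]])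
      (intro Suc.IH f(2))
qed

lemma continuously_differentiable_compose_linear:
  assumes "bounded_linear L"
  shows "continuously_differentiable k f \<Longrightarrow> continuously_differentiable k (\<lambda>x. f (L x))"
proof (induction k arbitrary: f)
  case 0
  then show ?case
    using continuous_on_compose2[of UNIV f UNIV L] linear_continuous_on[OF assms] by simp
next
  case (Suc k)
  note f = continuously_differentiable_SucD[OF Suc.prems]
  show ?case
    by (rule continuously_differentiable_SucI[OF has_derivative_compose
          [OF bounded_linear_imp_has_derivative[OF assms] f(1)]])
      (rule Suc.IH[OF f(2)])
qed

text \<open>The derivative \<open>- f' / f\<^sup>2\<close> of \<open>1 / f\<close> contains \<open>1 / f\<close> again, so the induction hypothesis is
  needed for the same \<open>f\<close> at one order less. In the same way the derivative of \<open>sqrt f\<close> contains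
  \<open>1 / sqrt f\<close>.\<close>

lemma continuously_differentiable_inverse:
  fixes f :: "'a::real_normed_vector \<Rightarrow> real"
  assumes nz: "\<And>x. f x \<noteq> 0"
  shows "continuously_differentiable k f \<Longrightarrow> continuously_differentiable k (\<lambda>x. inverse (f x))"
proof (induction k)
  case 0
  then show ?case using nz by (auto intro!: continuous_intros)
next
  case (Suc k)
  note f = continuously_differentiable_SucD[OF Suc.prems]
  have IH: "continuously_differentiable k (\<lambda>x. inverse (f x))"
    using Suc by (blast intro: continuously_differentiable_Suc_imp)
  have D: "((\<lambda>x. inverse (f x)) has_derivative
      (\<lambda>v. - 1 * (inverse (f x) * frechet_derivative f (at x) v * inverse (f x)))) (at x)" for x
    using Deriv.has_derivative_inverse[OF nz f(1)] by simp
  show ?case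
    by (rule continuously_differentiable_SucI[OF D])
      (intro continuously_differentiable_mult continuously_differentiable_const f(2) IH)
qed

lemma continuously_differentiable_sqrt:
  fixes f :: "'a::real_normed_vector \<Rightarrow> real"
  assumes pos: "\<And>x. f x > 0"
  shows "continuously_differentiable k f \<Longrightarrow> continuously_differentiable k (\<lambda>x. sqrt (f x))"
proof (induction k)
  case 0
  then show ?case by (auto intro!: continuous_intros)
next
  case (Suc k)
  note f = continuously_differentiable_SucD[OF Suc.prems]
  have "continuously_differentiable k (\<lambda>x. sqrt (f x))"
    using Suc by (blast intro: continuously_differentiable_Suc_imp)
  then have IH: "continuously_differentiable k (\<lambda>x. inverse (sqrt (f x)))"
    using pos by (intro continuously_differentiable_inverse) (auto simp: less_le)
  have D: "((\<lambda>x. sqrt (f x)) has_derivative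
      (\<lambda>v. 1 / 2 * (frechet_derivative f (at x) v * inverse (sqrt (f x))))) (at x)" for x
    using pos[of x] by (auto intro!: derivative_eq_intros f(1) simp: field_simps)
  show ?case
    by (rule continuously_differentiable_SucI[OF D])
      (intro continuously_differentiable_mult continuously_differentiable_const f(2) IH)
qed

lemma smooth_const: "smooth (\<lambda>x. c)"
  by (simp add: smooth_def continuously_differentiable_const)

lemma smooth_bounded_linear: "bounded_linear L \<Longrightarrow> smooth L"
  by (simp add: smooth_def continuously_differentiable_bounded_linear)

lemma smooth_add: "smooth f \<Longrightarrow> smooth g \<Longrightarrow> smooth (\<lambda>x. f x + g x)"
  by (simp add: smooth_def continuously_differentiable_add)

lemma smooth_linear_compose: "bounded_linear L \<Longrightarrow> smooth f \<Longrightarrow> smooth (\<lambda>x. L (f x))"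
  by (simp add: smooth_def continuously_differentiable_linear_compose)

lemma smooth_compose_linear: "bounded_linear L \<Longrightarrow> smooth f \<Longrightarrow> smooth (\<lambda>x. f (L x))"
  by (simp add: smooth_def continuously_differentiable_compose_linear)

lemma smooth_frechet_derivative: "smooth f \<Longrightarrow> smooth (\<lambda>x. frechet_derivative f (at x) v)"
  unfolding smooth_def by (blast intro: continuously_differentiable_SucD(2))

lemma smooth_mult:
  fixes f g :: "'a::euclidean_space \<Rightarrow> 'b::real_normed_algebra"
  shows "smooth f \<Longrightarrow> smooth g \<Longrightarrow> smooth (\<lambda>x. f x * g x)"
  unfolding smooth_def by (auto intro: continuously_differentiable_mult)

lemma smooth_divide:
  fixes f g :: "'a::euclidean_space \<Rightarrow> real"
  assumes "smooth f" "smooth g" "\<And>x. g x \<noteq> 0"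
  shows "smooth (\<lambda>x. f x / g x)"
  using assms(1,2) unfolding smooth_def divide_inverse
  by (intro allI continuously_differentiable_mult continuously_differentiable_inverse assms(3)) auto

lemma smooth_sqrt:
  fixes f :: "'a::euclidean_space \<Rightarrow> real"
  shows "smooth f \<Longrightarrow> (\<And>x. f x > 0) \<Longrightarrow> smooth (\<lambda>x. sqrt (f x))"
  unfolding smooth_def by (auto intro: continuously_differentiable_sqrt)

lemma smooth_sum:
  "(\<And>i. i \<in> I \<Longrightarrow> smooth (f i)) \<Longrightarrow> smooth (\<lambda>x. \<Sum>i\<in>I. f i x)"
  by (induction I rule: infinite_finite_induct) (auto intro: smooth_const smooth_add)

lemma smooth_prod:
  fixes f :: "'i \<Rightarrow> 'a::euclidean_space \<Rightarrow> real"
  shows "(\<And>i. i \<in> I \<Longrightarrow> smooth (f i)) \<Longrightarrow> smooth (\<lambda>x. \<Prod>i\<in>I. f i x)"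
  by (induction I rule: infinite_finite_induct) (auto intro: smooth_const smooth_mult)

lemma smooth_has_derivative:
  "smooth f \<Longrightarrow> (f has_derivative frechet_derivative f (at x)) (at x)"
  unfolding smooth_def by (blast intro: continuously_differentiable_SucD)

lemma smooth_tensor:
  fixes f :: "'a::euclidean_space \<Rightarrow> 'c::real_normed_algebra" and h :: "'b::euclidean_space \<Rightarrow> 'c"
  assumes "smooth f" "smooth h"
  shows "smooth (\<lambda>q. f (fst q) * h (snd q))"
  by (intro smooth_mult smooth_compose_linear[OF bounded_linear_fst assms(1)]
      smooth_compose_linear[OF bounded_linear_snd assms(2)])

lemma frechet_derivative_tensor:
  fixes F :: "'a::euclidean_space \<Rightarrow> real" and H :: "'b::euclidean_space \<Rightarrow> real"
  assumes "smooth F" "smooth H"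
  shows "frechet_derivative (\<lambda>q. F (fst q) * H (snd q)) (at q) v =
    F (fst q) * frechet_derivative H (at (snd q)) (snd v) +
    frechet_derivative F (at (fst q)) (fst v) * H (snd q)"
proof -
  have "((\<lambda>q. F (fst q) * H (snd q)) has_derivative
      (\<lambda>v. F (fst q) * frechet_derivative H (at (snd q)) (snd v) +
        frechet_derivative F (at (fst q)) (fst v) * H (snd q))) (at q)"
    by (intro has_derivative_mult
        has_derivative_compose[OF bounded_linear_imp_has_derivative[OF bounded_linear_fst]
          smooth_has_derivative[OF assms(1)]]
        has_derivative_compose[OF bounded_linear_imp_has_derivative[OF bounded_linear_snd]
          smooth_has_derivative[OF assms(2)]])
  from frechet_derivative_at[OF this] show ?thesis
    by (metis (no_types, lifting))
qed

section \<open>The Laplace-Beltrami operator of a diagonal metric\<close>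

text \<open>Diagonality refers to the coordinate basis only. Unlike conformal flatness, it is inherited by
  products: \<open>Basis\<close> of a product type consists of the basis vectors of the two factors.\<close>

definition smooth_diagonal_metric :: "'a::euclidean_space metric \<Rightarrow> bool" where
  "smooth_diagonal_metric g \<longleftrightarrow>
     (\<forall>x. bilinear (g x)) \<and>
     (\<forall>x. \<forall>b\<in>Basis. \<forall>c\<in>Basis. b \<noteq> c \<longrightarrow> g x b c = 0) \<and>
     (\<forall>x. \<forall>b\<in>Basis. g x b b > 0) \<and>
     (\<forall>b\<in>Basis. smooth (\<lambda>x. g x b b))"

lemma smooth_diagonal_metricD:
  assumes "smooth_diagonal_metric g"
  shows "bilinear (g x)"
    and "b \<in> Basis \<Longrightarrow> c \<in> Basis \<Longrightarrow> b \<noteq> c \<Longrightarrow> g x b c = 0"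
    and "b \<in> Basis \<Longrightarrow> g x b b > 0"
    and "b \<in> Basis \<Longrightarrow> smooth (\<lambda>x. g x b b)"
  using assms by (auto simp: smooth_diagonal_metric_def)

lemma diagonal_metric_basis:
  assumes g: "smooth_diagonal_metric g" and c: "c \<in> Basis"
  shows "g x w c = (w \<bullet> c) * g x c c"
proof -
  note bil = smooth_diagonal_metricD(1)[OF g]
  have lin: "linear (\<lambda>w. g x w c)"
    using bil[of x] by (simp add: bilinear_def)
  have "g x w c = g x (\<Sum>b\<in>Basis. (w \<bullet> b) *\<^sub>R b) c"
    by (simp add: euclidean_representation)
  also have "\<dots> = (\<Sum>b\<in>Basis. (w \<bullet> b) * g x b c)"
    by (simp add: linear_sum[OF lin] linear_cmul[OF lin])
  also have "\<dots> = (\<Sum>b\<in>Basis. if b = c then (w \<bullet> c) * g x c c else 0)"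
    using smooth_diagonal_metricD(2)[OF g _ c] by (intro sum.cong) auto
  finally show ?thesis using c by simp
qed

lemma riemannian_gradient_diagonal:
  assumes g: "smooth_diagonal_metric g" and u: "smooth u" and b: "b \<in> Basis"
  shows "riemannian_gradient g u x \<bullet> b = frechet_derivative u (at x) b / g x b b"
proof -
  let ?D = "frechet_derivative u (at x)"
  have linD: "linear ?D"
    using smooth_has_derivative[OF u] has_derivative_linear by blast
  have ling: "linear (g x w)" for w
    using smooth_diagonal_metricD(1)[OF g, of x] by (simp add: bilinear_def)
  \<comment> \<open>Both sides of the defining equation of the gradient are linear, so it can be tested on the
    basis, where it fixes the components of the gradient one by one.\<close>
  have iff: "(\<forall>v. g x w v = ?D v) \<longleftrightarrow> (\<forall>c\<in>Basis. w \<bullet> c = ?D c / g x c c)" for w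
  proof -
    have "(\<forall>v. g x w v = ?D v) \<longleftrightarrow> (\<forall>c\<in>Basis. g x w c = ?D c)"
      using linear_eq_stdbasis[OF ling linD] by metis
    also have "\<dots> \<longleftrightarrow> (\<forall>c\<in>Basis. w \<bullet> c = ?D c / g x c c)"
    proof (intro ball_cong refl)
      fix c :: 'a assume c: "c \<in> Basis"
      show "g x w c = ?D c \<longleftrightarrow> w \<bullet> c = ?D c / g x c c"
        using smooth_diagonal_metricD(3)[OF g c, of x]
        by (subst diagonal_metric_basis[OF g c]) (simp add: eq_divide_eq)
    qed
    finally show ?thesis .
  qed
  let ?w = "\<Sum>c\<in>Basis. (?D c / g x c c) *\<^sub>R c"
  have w: "\<forall>c\<in>Basis. ?w \<bullet> c = ?D c / g x c c"
    by simp
  have "riemannian_gradient g u x = ?w"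
    unfolding riemannian_gradient_def iff
  proof (rule the_equality, rule w, rule euclidean_eqI)
    fix w' c assume "\<forall>c\<in>Basis. w' \<bullet> c = ?D c / g x c c" and "(c::'a) \<in> Basis"
    with w show "w' \<bullet> c = ?w \<bullet> c" by metis
  qed
  then show ?thesis using w b by simp
qed

text \<open>A permutation other than the identity moves some \<open>b\<close>, and its term in the Leibniz formula
  contains the off-diagonal factor \<open>g x b (\<pi> b) = 0\<close>.\<close>

lemma volume_density_diagonal:
  assumes g: "smooth_diagonal_metric g"
  shows "volume_density g x = sqrt (\<Prod>b\<in>Basis. g x b b)"
proof -
  let ?t = "\<lambda>\<pi>. of_int (sign \<pi>) * (\<Prod>b\<in>Basis. g x b (\<pi> b))"
  have "?t \<pi> = 0" if \<pi>: "\<pi> permutes Basis" "\<pi> \<noteq> id" for \<pi>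
  proof -
    obtain b where "\<pi> b \<noteq> b" using \<pi>(2) by (auto simp: fun_eq_iff)
    moreover from this have "b \<in> Basis" using \<pi>(1) by (meson permutes_not_in)
    ultimately have "g x b (\<pi> b) = 0"
      using smooth_diagonal_metricD(2)[OF g, of b "\<pi> b"] permutes_in_image[OF \<pi>(1)] by auto
    then show ?thesis using \<open>b \<in> Basis\<close> by (auto intro!: prod_zero)
  qed
  then have "(\<Sum>\<pi> | \<pi> permutes Basis. ?t \<pi>) = (\<Sum>\<pi>\<in>{id}. ?t \<pi>)"
    by (intro sum.mono_neutral_right) (auto simp: finite_permutations)
  then show ?thesis by (simp add: volume_density_def)
qed

lemma volume_density_diagonal_pos:
  assumes "smooth_diagonal_metric g"
  shows "volume_density g x > 0"
  using smooth_diagonal_metricD(3)[OF assms]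
  by (simp add: volume_density_diagonal[OF assms] prod_pos)

lemma smooth_volume_density_diagonal:
  assumes "smooth_diagonal_metric g"
  shows "smooth (volume_density g)"
proof -
  have "smooth (\<lambda>x. sqrt (\<Prod>b\<in>Basis. g x b b))"
    using smooth_diagonal_metricD[OF assms] by (intro smooth_sqrt smooth_prod prod_pos) auto
  then show ?thesis
    using volume_density_diagonal[OF assms] by presburger
qed

text \<open>The component along \<open>b\<close> of \<open>\<rho> grad u\<close>, the vector density whose coordinate divergence is
  \<open>\<rho> \<Delta>u\<close>.\<close>

definition gradient_flux ::
    "'a::euclidean_space metric \<Rightarrow> ('a \<Rightarrow> real) \<Rightarrow> 'a \<Rightarrow> 'a \<Rightarrow> real" where
  "gradient_flux g u b x = volume_density g x * (frechet_derivative u (at x) b / g x b b)"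

lemma smooth_gradient_flux:
  assumes g: "smooth_diagonal_metric g" and u: "smooth u" and b: "b \<in> Basis"
  shows "smooth (gradient_flux g u b)"
proof -
  have "smooth (\<lambda>x. volume_density g x * (frechet_derivative u (at x) b / g x b b))"
    using smooth_diagonal_metricD(3,4)[OF g b]
    by (intro smooth_mult smooth_divide smooth_frechet_derivative
        smooth_volume_density_diagonal g u) (auto simp: less_le)
  then show ?thesis by (simp add: gradient_flux_def[abs_def])
qed

lemma laplace_beltrami_real_diagonal:
  assumes "smooth_diagonal_metric g" and "smooth u"
  shows "laplace_beltrami_real g u x =
    (\<Sum>b\<in>Basis. frechet_derivative (gradient_flux g u b) (at x) b) / volume_density g x"
  unfolding laplace_beltrami_real_def riemannian_divergence_def gradient_flux_def[abs_def]
  by (intro arg_cong2[where f = "(/)"] sum.cong refl)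
    (simp add: riemannian_gradient_diagonal[OF assms])

text \<open>The formula for the operator in a diagonal metric involves only derivatives, sums, products,
  quotients with a positive denominator and the smooth density, so it preserves smoothness. This is
  what allows the operator to be iterated.\<close>

lemma smooth_laplace_beltrami_real:
  assumes g: "smooth_diagonal_metric g" and u: "smooth u"
  shows "smooth (laplace_beltrami_real g u)"
proof -
  have "smooth (\<lambda>x. \<Sum>b\<in>Basis. frechet_derivative (gradient_flux g u b) (at x) b)"
    using smooth_frechet_derivative[OF smooth_gradient_flux[OF g u]] by (rule smooth_sum)
  moreover have "volume_density g x \<noteq> 0" for x
    using volume_density_diagonal_pos[OF g, of x] by simp
  ultimately have "smooth (\<lambda>x. (\<Sum>b\<in>Basis. frechet_derivative (gradient_flux g u b) (at x) b)
      / volume_density g x)"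
    by (intro smooth_divide smooth_volume_density_diagonal[OF g])
  then show ?thesis
    using laplace_beltrami_real_diagonal[OF g u] by presburger
qed

section \<open>Products of diagonal metrics\<close>

lemma Basis_product_cases:
  assumes "b \<in> (Basis :: ('a::euclidean_space \<times> 'b::euclidean_space) set)"
  obtains c where "c \<in> Basis" "b = (c, 0)" | d where "d \<in> Basis" "b = (0, d)"
  using assms by (auto simp: Basis_prod_def)

lemma product_metric_basis:
  assumes "smooth_diagonal_metric g" "smooth_diagonal_metric k"
  shows "product_metric g k q (c, 0) (c', 0) = g (fst q) c c'"
    and "product_metric g k q (0, d) (0, d') = k (snd q) d d'"
    and "product_metric g k q (c, 0) (0, d) = 0"
    and "product_metric g k q (0, d) (c, 0) = 0"
  using smooth_diagonal_metricD(1)[OF assms(1)] smooth_diagonal_metricD(1)[OF assms(2)]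
  by (auto simp: product_metric_def bilinear_lzero bilinear_rzero)

lemma smooth_diagonal_product_metric:
  assumes g: "smooth_diagonal_metric g" and k: "smooth_diagonal_metric k"
  shows "smooth_diagonal_metric (product_metric g k)"
proof -
  note gD = smooth_diagonal_metricD[OF g] and kD = smooth_diagonal_metricD[OF k]
  note pm = product_metric_basis[OF g k]
  have bil: "bilinear (product_metric g k q)" for q
  proof -
    note bg = gD(1)[of "fst q"] and bk = kD(1)[of "snd q"]
    show ?thesis
      unfolding bilinear_def linear_iff product_metric_def
      by (simp add: bilinear_ladd[OF bg] bilinear_radd[OF bg] bilinear_lmul[OF bg]
          bilinear_rmul[OF bg] bilinear_ladd[OF bk] bilinear_radd[OF bk] bilinear_lmul[OF bk]
          bilinear_rmul[OF bk] distrib_left)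
  qed
  have off: "product_metric g k q b c = 0" if b: "b \<in> Basis" and c: "c \<in> Basis" and "b \<noteq> c" for q b c
    using that(3) by (cases rule: Basis_product_cases[OF b]; cases rule: Basis_product_cases[OF c])
      (auto simp: pm gD(2) kD(2))
  have diag: "0 < product_metric g k q b b" if b: "b \<in> Basis" for q b
    by (cases rule: Basis_product_cases[OF b]) (auto simp: pm gD(3) kD(3))
  have sm: "smooth (\<lambda>q. product_metric g k q b b)" if b: "b \<in> Basis" for b
    by (cases rule: Basis_product_cases[OF b])
      (auto simp: pm smooth_compose_linear[OF bounded_linear_fst gD(4)]
        smooth_compose_linear[OF bounded_linear_snd kD(4)])
  show ?thesis
    unfolding smooth_diagonal_metric_def using bil off diag sm by blast
qed

lemma sum_Basis_product:
  fixes F :: "'a::euclidean_space \<times> 'b::euclidean_space \<Rightarrow> real"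
  shows "(\<Sum>b\<in>Basis. F b) = (\<Sum>c\<in>Basis. F (c, 0)) + (\<Sum>d\<in>Basis. F (0, d))"
  unfolding Basis_prod_def
  by (subst sum.union_disjoint) (auto simp: Basis_prod_def sum.reindex inj_on_def)

lemma prod_Basis_product:
  fixes F :: "'a::euclidean_space \<times> 'b::euclidean_space \<Rightarrow> real"
  shows "(\<Prod>b\<in>Basis. F b) = (\<Prod>c\<in>Basis. F (c, 0)) * (\<Prod>d\<in>Basis. F (0, d))"
  unfolding Basis_prod_def
  by (subst prod.union_disjoint) (auto simp: Basis_prod_def prod.reindex inj_on_def)

lemma volume_density_product:
  assumes g: "smooth_diagonal_metric g" and k: "smooth_diagonal_metric k"
  shows "volume_density (product_metric g k) q = volume_density g (fst q) * volume_density k (snd q)"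
  by (simp add: volume_density_diagonal g k smooth_diagonal_product_metric prod_Basis_product
      product_metric_basis[OF g k] real_sqrt_mult)

text \<open>In a direction tangent to one factor, the other factor enters the flux of \<open>u(x) h(y)\<close> only
  through its density and its function, as a multiplier that is constant in that direction.\<close>

lemma gradient_flux_product:
  assumes g: "smooth_diagonal_metric g" and k: "smooth_diagonal_metric k"
    and u: "smooth u" and h: "smooth h"
  shows "gradient_flux (product_metric g k) (\<lambda>q. u (fst q) * h (snd q)) (c, 0) =
      (\<lambda>q. gradient_flux g u c (fst q) * (volume_density k (snd q) * h (snd q)))"
    and "gradient_flux (product_metric g k) (\<lambda>q. u (fst q) * h (snd q)) (0, d) =
      (\<lambda>q. (volume_density g (fst q) * u (fst q)) * gradient_flux k h d (snd q))"
proof -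
  have "linear (frechet_derivative u (at x))" "linear (frechet_derivative h (at y))" for x y
    using smooth_has_derivative[OF u] smooth_has_derivative[OF h] has_derivative_linear by blast+
  then have [simp]: "frechet_derivative u (at x) 0 = 0" "frechet_derivative h (at y) 0 = 0" for x y
    by (auto simp: linear_0)
  show "gradient_flux (product_metric g k) (\<lambda>q. u (fst q) * h (snd q)) (c, 0) =
      (\<lambda>q. gradient_flux g u c (fst q) * (volume_density k (snd q) * h (snd q)))"
    and "gradient_flux (product_metric g k) (\<lambda>q. u (fst q) * h (snd q)) (0, d) =
      (\<lambda>q. (volume_density g (fst q) * u (fst q)) * gradient_flux k h d (snd q))"
    by (simp_all add: fun_eq_iff gradient_flux_def volume_density_product[OF g k]
        frechet_derivative_tensor[OF u h] product_metric_basis[OF g k])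
qed

text \<open>In the quotient by the density \<open>\<rho>(x) \<sigma>(y)\<close> of the product, the multiplier \<open>\<sigma>(y) h(y)\<close> of the
  first block of fluxes leaves \<open>h(y)\<close>, and the multiplier \<open>\<rho>(x) u(x)\<close> of the second leaves \<open>u(x)\<close>.\<close>

theorem laplace_beltrami_real_product:
  assumes g: "smooth_diagonal_metric g" and k: "smooth_diagonal_metric k"
    and u: "smooth u" and h: "smooth h"
  shows "laplace_beltrami_real (product_metric g k) (\<lambda>q. u (fst q) * h (snd q)) (x, y) =
    laplace_beltrami_real g u x * h y + u x * laplace_beltrami_real k h y"
proof -
  let ?\<rho> = "volume_density g" and ?\<sigma> = "volume_density k"
  let ?U = "\<lambda>q. u (fst q) * h (snd q)"
  note \<rho> = smooth_volume_density_diagonal[OF g] and \<sigma> = smooth_volume_density_diagonal[OF k]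
  have zero: "frechet_derivative F (at z) 0 = 0" if "smooth F"
    for F :: "'c::euclidean_space \<Rightarrow> real" and z
    using smooth_has_derivative[OF that] has_derivative_linear linear_0 by blast
  have 1: "frechet_derivative (gradient_flux (product_metric g k) ?U (c, 0)) (at (x, y)) (c, 0) =
      frechet_derivative (gradient_flux g u c) (at x) c * (?\<sigma> y * h y)" if "c \<in> Basis" for c
    unfolding gradient_flux_product[OF g k u h]
    by (subst frechet_derivative_tensor[OF smooth_gradient_flux[OF g u that] smooth_mult[OF \<sigma> h]])
      (simp add: zero[OF smooth_mult[OF \<sigma> h]])
  have 2: "frechet_derivative (gradient_flux (product_metric g k) ?U (0, d)) (at (x, y)) (0, d) =
      (?\<rho> x * u x) * frechet_derivative (gradient_flux k h d) (at y) d" if "d \<in> Basis" for d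
    unfolding gradient_flux_product[OF g k u h]
    by (subst frechet_derivative_tensor[OF smooth_mult[OF \<rho> u] smooth_gradient_flux[OF k h that]])
      (simp add: zero[OF smooth_mult[OF \<rho> u]])
  have pos: "?\<rho> x > 0" "?\<sigma> y > 0"
    using volume_density_diagonal_pos g k by blast+
  have "laplace_beltrami_real (product_metric g k) ?U (x, y) =
      ((\<Sum>c\<in>Basis. frechet_derivative (gradient_flux g u c) (at x) c) * (?\<sigma> y * h y) +
       (?\<rho> x * u x) * (\<Sum>d\<in>Basis. frechet_derivative (gradient_flux k h d) (at y) d))
      / (?\<rho> x * ?\<sigma> y)"
    by (simp add: laplace_beltrami_real_diagonal smooth_diagonal_product_metric g k
        smooth_tensor u h sum_Basis_product 1 2 volume_density_product sum_distrib_left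
        sum_distrib_right cong: sum.cong_simp)
  then show ?thesis
    using pos by (simp add: laplace_beltrami_real_diagonal g k u h field_simps)
qed

section \<open>Products of biharmonic and harmonic functions\<close>

text \<open>As \<open>h\<close> is real, the real and the imaginary part of \<open>f h\<close> are products to which the Leibniz rule
  for the real operator applies. Smoothness is demanded of the two parts of \<open>f\<close> because this is the
  form in which it is known for a function \<open>\<Delta>f\<close>, to which the identity is applied the second time.\<close>

lemma laplace_beltrami_product_harmonic:
  assumes g: "smooth_diagonal_metric g" and k: "smooth_diagonal_metric k"
    and f: "smooth (\<lambda>x. Re (f x))" "smooth (\<lambda>x. Im (f x))"
    and h: "smooth h" "\<And>y. laplace_beltrami_real k h y = 0"
  shows "laplace_beltrami (product_metric g k) (\<lambda>q. f (fst q) * complex_of_real (h (snd q))) =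
    (\<lambda>q. laplace_beltrami g f (fst q) * complex_of_real (h (snd q)))"
proof
  fix q :: "'a \<times> 'b"
  obtain x y where q: "q = (x, y)" by (cases q)
  show "laplace_beltrami (product_metric g k) (\<lambda>q. f (fst q) * complex_of_real (h (snd q))) q =
      laplace_beltrami g f (fst q) * complex_of_real (h (snd q))"
    using laplace_beltrami_real_product[OF g k f(1) h(1), of x y]
      laplace_beltrami_real_product[OF g k f(2) h(1), of x y] h(2)
    by (simp add: laplace_beltrami_def complex_eq_iff q)
qed

theorem proper_biharmonic_product:
  assumes g: "smooth_diagonal_metric g" and k: "smooth_diagonal_metric k"
    and f: "proper_biharmonic g f"
    and h: "harmonic k (\<lambda>y. complex_of_real (h y))" and nz: "h y0 \<noteq> 0"
  shows "proper_biharmonic (product_metric g k) (\<lambda>q. f (fst q) * complex_of_real (h (snd q)))"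
proof -
  let ?\<Delta>f = "laplace_beltrami g f"
  have fs: "smooth f" using f by (simp add: proper_biharmonic_def)
  note fRI = smooth_linear_compose[OF bounded_linear_Re fs]
    smooth_linear_compose[OF bounded_linear_Im fs]
  have hs: "smooth (\<lambda>y. complex_of_real (h y))"
    using h by (simp add: harmonic_def)
  have h1: "smooth h"
    using smooth_linear_compose[OF bounded_linear_Re hs] by simp
  have h2: "laplace_beltrami_real k h y = 0" for y
    using h by (simp add: harmonic_def laplace_beltrami_def complex_eq_iff)
  have \<Delta>RI: "smooth (\<lambda>x. Re (?\<Delta>f x))" "smooth (\<lambda>x. Im (?\<Delta>f x))"
    using smooth_laplace_beltrami_real[OF g fRI(1)] smooth_laplace_beltrami_real[OF g fRI(2)]
    by (simp_all add: laplace_beltrami_def)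
  note once = laplace_beltrami_product_harmonic[OF g k fRI h1 h2]
  note twice = laplace_beltrami_product_harmonic[OF g k \<Delta>RI h1 h2]
  obtain x0 where "?\<Delta>f x0 \<noteq> 0" using f by (auto simp: proper_biharmonic_def)
  with nz have "?\<Delta>f (fst (x0, y0)) * complex_of_real (h (snd (x0, y0))) \<noteq> 0" by simp
  then show ?thesis
    using f smooth_tensor[OF fs hs] unfolding proper_biharmonic_def once twice
    by (metis (no_types, lifting) mult_zero_left)
qed

section \<open>The punctured sphere and the line\<close>

lemma smooth_diagonal_flat_metric: "smooth_diagonal_metric flat_metric"
  by (auto simp: smooth_diagonal_metric_def flat_metric_def bilinear_def linear_iff
      inner_simps inner_not_same_Basis smooth_const)

lemma smooth_diagonal_punctured_sphere_metric: "smooth_diagonal_metric punctured_sphere_metric"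
proof -
  have pos: "1 + ((Re z)\<^sup>2 + (Im z)\<^sup>2) > 0" for z
    by (simp add: add_pos_nonneg)
  have "smooth (\<lambda>z::complex. 4 / (1 + ((Re z)\<^sup>2 + (Im z)\<^sup>2))\<^sup>2)"
    using pos unfolding power2_eq_square
    by (intro smooth_divide smooth_mult smooth_add smooth_const
        smooth_bounded_linear[OF bounded_linear_Re] smooth_bounded_linear[OF bounded_linear_Im]) (force simp: less_le)
  then show ?thesis
    using pos
    by (auto simp: smooth_diagonal_metric_def punctured_sphere_metric_def bilinear_def linear_iff
        inner_simps inner_not_same_Basis algebra_simps add_divide_distrib less_le)
qed

theorem corollary7p4:
  fixes f :: "complex \<Rightarrow> complex" and p :: "real poly" and a\<^sub>0 a\<^sub>1 :: real
  assumes "proper_biharmonic punctured_sphere_metric f"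
    and "p = [:a\<^sub>0, a\<^sub>1:]" and "p \<noteq> 0"
    and "harmonic flat_metric (\<lambda>t::real. complex_of_real (poly p t))"
  shows "proper_biharmonic (product_metric punctured_sphere_metric (flat_metric :: real metric))
           (\<lambda>(z, t). f z * complex_of_real (poly p t))"
proof -
  obtain t0 where "poly p t0 \<noteq> 0"
    using assms(3) poly_all_0_iff_0 by blast
  from proper_biharmonic_product[OF smooth_diagonal_punctured_sphere_metric
      smooth_diagonal_flat_metric assms(1) assms(4) this]
  show ?thesis by (simp add: case_prod_beta')
qed

end
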